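(* Let $\mathbb{X}$ be a finite subset of the projective space $\mathbb{P}^{s-1}$ over a field $K$ and let $I(\mathbb{X})\subset S=K[t_1,\ldots,t_s]$ be its vanishing ideal. If $F=\{f_1,\ldots,f_r\}$ is a set of homogeneous polynomials of $S\setminus\{0\}$, then $$ |\mathbb{X}\setminus V_{\mathbb{X}}(F)|=\left\{ \begin{array}{cl} \deg(S/(I(\mathbb{X})\colon(F)))&\mbox{if }(I(\mathbb{X})\colon(F))\neq I(\mathbb{X}),\\ \deg(S/I(\mathbb{X}))&\mbox{if }(I(\mathbb{X})\colon(F))=I(\mathbb{X}). \end{array}\right. $$
   Context: $S=K[t_1,\ldots,t_s]=\bigoplus_{d\ge0} S_d$ has the standard grading; $r\geq 1$. $I(\mathbb{X})$ is the ideal generated by the homogeneous polynomials vanishing at all points of $\mathbb{X}$; $V_\mathbb{X}(F)$ is the set of $[\alpha]\in\mathbb{X}$ with $f(\alpha)=0$ for all $f\in F$; $(I\colon(F))=\{g\in S : gf\in I\ \forall f\in F\}$. For a graded ideal $I$ with Hilbert function $H_I(d)=\dim_K(S_d/(I\cap S_d))$ and $k=\dim(S/I)$ the Krull dimension, $\deg(S/I)=(k-1)!\lim_{d\to\infty}H_I(d)/d^{k-1}$ if $k\geq 1$, and $\deg(S/I)=\dim_K(S/I)$ if $k=0$; the zero ring has degree $0$. *)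

theory Defs
  imports
    "HOL-Algebra.Algebraic_Closure_Type"
    "HOL-Algebra.QuotRing"
    "HOL-Analysis.Finite_Cartesian_Product"
    "HOL-Library.Poly_Mapping"
    "HOL-Library.Extended_Nat"
begin

section \<open>Polynomials\<close>

text \<open>
  The ring \<open>S = K[t_1, ..., t_s]\<close>: the variables are indexed by the elements of the finite type
  \<open>'n\<close>, so \<open>s = CARD('n)\<close>; a polynomial is a finitely supported map from monomials (exponent
  vectors) to coefficients. \<^const>\<open>ring_of_type_algebra\<close> turns it into a ring with carrier
  \<open>UNIV\<close>.
\<close>

type_synonym ('n, 'k) mpoly = "('n \<Rightarrow>\<^sub>0 nat) \<Rightarrow>\<^sub>0 'k"

abbreviation poly_ring :: "('n::finite, 'k::field) mpoly ring" where
  "poly_ring \<equiv> ring_of_type_algebra"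

definition mon_degree :: "('n::finite \<Rightarrow>\<^sub>0 nat) \<Rightarrow> nat" where
  "mon_degree m = (\<Sum>i\<in>UNIV. Poly_Mapping.lookup m i)"

definition graded_part :: "nat \<Rightarrow> ('n::finite, 'k::field) mpoly set" where
  "graded_part d = {p. \<forall>m\<in>Poly_Mapping.keys p. mon_degree m = d}"

text \<open>The zero polynomial counts as homogeneous (of every degree).\<close>

definition homogeneous :: "('n::finite, 'k::field) mpoly \<Rightarrow> bool" where
  "homogeneous p \<longleftrightarrow> (\<exists>d. p \<in> graded_part d)"

definition mpoly_eval :: "('n::finite, 'k::field) mpoly \<Rightarrow> 'k ^ 'n \<Rightarrow> 'k" where
  "mpoly_eval p x = (\<Sum>m\<in>Poly_Mapping.keys p. Poly_Mapping.lookup p m * (\<Prod>i\<in>UNIV. (x $ i) ^ Poly_Mapping.lookup m i))"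

definition mpoly_scale :: "'k::field \<Rightarrow> ('n::finite, 'k) mpoly \<Rightarrow> ('n, 'k) mpoly" where
  "mpoly_scale c p = Poly_Mapping.single 0 c * p"


section \<open>Projective space and vanishing ideals\<close>

definition proj_space :: "('k::field ^ 'n::finite) set set" where
  "proj_space =
     {x. x \<noteq> 0} // {(x, y). x \<noteq> 0 \<and> y \<noteq> 0 \<and> (\<exists>c. c \<noteq> 0 \<and> y = c *s x)}"

text \<open>
  Vanishing at a projective point is required for all of its representatives; for homogeneous
  polynomials, the only ones considered below, it does not depend on the representative.
\<close>

definition vanishes_at :: "('n::finite, 'k::field) mpoly \<Rightarrow> ('k ^ 'n) set \<Rightarrow> bool" where
  "vanishes_at f P \<longleftrightarrow> (\<forall>x\<in>P. mpoly_eval f x = 0)"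

definition vanishing_ideal :: "('k::field ^ 'n::finite) set set \<Rightarrow> ('n, 'k) mpoly set" where
  "vanishing_ideal \<X> = Idl\<^bsub>poly_ring\<^esub> {f. homogeneous f \<and> (\<forall>P\<in>\<X>. vanishes_at f P)}"

definition zero_locus ::
    "('k::field ^ 'n::finite) set set \<Rightarrow> ('n, 'k) mpoly set \<Rightarrow> ('k ^ 'n) set set" where
  "zero_locus \<X> F = {P \<in> \<X>. \<forall>f\<in>F. vanishes_at f P}"

definition colon_ideal ::
    "('n::finite, 'k::field) mpoly set \<Rightarrow> ('n, 'k) mpoly set \<Rightarrow> ('n, 'k) mpoly set" where
  "colon_ideal I F = {g. \<forall>f\<in>F. g * f \<in> I}"


section \<open>Dimension and degree\<close>

text \<open>
  For subspaces \<open>W \<subseteq> V\<close> and scalar multiplication \<open>smul\<close>, \<open>quotient_basis smul V W B\<close> says that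
  the residue classes of the elements of \<open>B\<close> are pairwise distinct and form a basis of the quotient
  space \<open>V / W\<close>. If \<open>V / W\<close> is infinite-dimensional, \<open>quotient_dim\<close> is \<open>0\<close>, as usual for
  \<^const>\<open>card\<close>.
\<close>

definition quotient_basis ::
    "('k::field \<Rightarrow> 'v::ab_group_add \<Rightarrow> 'v) \<Rightarrow> 'v set \<Rightarrow> 'v set \<Rightarrow> 'v set \<Rightarrow> bool" where
  "quotient_basis smul V W B \<longleftrightarrow>
     B \<subseteq> V \<and>
     (\<forall>T u. finite T \<and> T \<subseteq> B \<and> (\<Sum>b\<in>T. smul (u b) b) \<in> W \<longrightarrow> (\<forall>b\<in>T. u b = 0)) \<and>
     (\<forall>v\<in>V. \<exists>T u. finite T \<and> T \<subseteq> B \<and> v - (\<Sum>b\<in>T. smul (u b) b) \<in> W)"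

definition quotient_dim ::
    "('k::field \<Rightarrow> 'v::ab_group_add \<Rightarrow> 'v) \<Rightarrow> 'v set \<Rightarrow> 'v set \<Rightarrow> nat" where
  "quotient_dim smul V W = card (SOME B. quotient_basis smul V W B)"

global_interpretation mpoly: vector_space
  "mpoly_scale :: 'k::field \<Rightarrow> ('n::finite, 'k) mpoly \<Rightarrow> ('n, 'k) mpoly"
proof
  fix a b :: 'k and x y :: "('n, 'k) mpoly"
  show "mpoly_scale a (x + y) = mpoly_scale a x + mpoly_scale a y"
    by (simp add: mpoly_scale_def distrib_left)
  show "mpoly_scale (a + b) x = mpoly_scale a x + mpoly_scale b x"
    by (simp add: mpoly_scale_def single_add distrib_right)
  show "mpoly_scale a (mpoly_scale b x) = mpoly_scale (a * b) x"
    by (simp add: mpoly_scale_def mult.assoc[symmetric] mult_single)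
  show "mpoly_scale 1 x = x"
    by (simp add: mpoly_scale_def)
qed

definition hilbert_function :: "('n::finite, 'k::field) mpoly set \<Rightarrow> nat \<Rightarrow> nat" where
  "hilbert_function I d = quotient_dim mpoly_scale (graded_part d) (I \<inter> graded_part d)"

text \<open>
  The supremum of the lengths of chains of prime ideals. It is \<open>0\<close>, not \<open>-\<infinity>\<close>, for the zero ring,
  which the definition of the degree treats separately.
\<close>

definition krull_dim :: "('a, 'b) ring_scheme \<Rightarrow> enat" where
  "krull_dim R =
     Sup {enat n | n. \<exists>P. (\<forall>i\<le>n. primeideal (P i) R) \<and> (\<forall>i<n. P i \<subset> P (Suc i))}"

text \<open>\<open>quotient_degree I\<close> is the degree of \<open>S/I\<close> for a graded ideal \<open>I\<close> of \<open>S\<close>.\<close>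

definition quotient_degree :: "('n::finite, 'k::field) mpoly set \<Rightarrow> real" where
  "quotient_degree I =
     (if I = UNIV then 0
      else let k = the_enat (krull_dim (poly_ring Quot I)) in
        if k \<ge> 1
        then fact (k - 1) * lim (\<lambda>d. real (hilbert_function I d) / real d ^ (k - 1))
        else real (quotient_dim mpoly_scale UNIV I))"

end

theory Submission
  imports Defs
begin

text \<open>
  The colon ideal of a vanishing ideal is again a vanishing ideal: \<open>(I(\<X>) : F) = I(\<X> - V(F))\<close>,
  because a product vanishes at a point exactly if one of the factors does. So it is enough to show
  that \<open>S/I(\<Y>)\<close> has degree \<open>card \<Y>\<close> for every finite set \<open>\<Y>\<close> of points, and the two cases of the
  theorem are instances of the same equation.

  Points are studied through the homomorphism \<open>line_restriction x\<close> from \<open>S\<close> to \<open>K[T]\<close> given by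
  \<open>t_i \<mapsto> x_i T\<close>. Its coefficients are the values at \<open>x\<close> of the homogeneous components, so its kernel
  is the ideal of the projective point \<open>[x]\<close>, and \<open>I(\<Y>)\<close> is the intersection of these kernels
  (\<open>mem_vanishing_ideal_iff\<close>). As \<open>K[T]\<close> is a domain, the formula for the colon ideal follows
  (\<open>colon_vanishing_ideal\<close>).

  The degree of \<open>S/I(\<Y>)\<close> has two ingredients. Products of linear forms separate the points of \<open>\<Y>\<close>
  in every degree \<open>d \<ge> card \<Y> - 1\<close>, so evaluation at the points identifies the degree \<open>d\<close> part of
  \<open>S/I(\<Y>)\<close> with \<open>K^\<Y>\<close>, and the Hilbert function has the value \<open>card \<Y>\<close>
  (\<open>hilbert_function_vanishing_ideal\<close>). The Krull dimension is \<open>1\<close> for nonempty \<open>\<Y>\<close>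
  (\<open>krull_dim_vanishing_ideal\<close>): a prime over \<open>I(\<Y>)\<close> contains the ideal of one of the points, and
  modulo that ideal \<open>S\<close> becomes the principal ideal domain \<open>K[T]\<close>.
\<close>

section \<open>Prime ideals of quotient rings\<close>

text \<open>
  The elements of a quotient ring are cosets, so the preimage of a set \<open>Q\<close> of cosets under the
  projection is \<open>\<Union>Q\<close>. Together with the next lemma this is the correspondence between the prime
  ideals of \<open>R/I\<close> and those of \<open>R\<close> that contain \<open>I\<close>.
\<close>

lemma (in cring) primeideal_quotient_Union:
  assumes I: "ideal I R" and Q: "primeideal Q (R Quot I)"
  shows "primeideal (\<Union>Q) R" and "I \<subseteq> \<Union>Q"
proof -
  interpret Q: primeideal Q "R Quot I" by fact
  interpret h: ring_hom_ring R "R Quot I" "(+>) I" by (rule ideal.rcos_ring_hom_ring[OF I])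
  have idQ: "ideal Q (R Quot I)" by (rule Q.ideal_axioms)
  have sub: "Q \<subseteq> carrier (R Quot I)" by (rule Q.a_subset)
  note mem = canonical_proj_vimage_mem_iff[OF I sub]
  have id: "ideal (\<Union>Q) R" by (rule quot_ideal_imp_ring_ideal[OF I idQ])
  have one: "\<one> \<notin> \<Union>Q"
    using mem[of \<one>] Q.I_notcarr Q.one_imp_carrier h.hom_one by auto
  show "primeideal (\<Union>Q) R"
  proof (rule primeidealI[OF id is_cring])
    show "carrier R \<noteq> \<Union>Q" using one by auto
    fix a b assume ab: "a \<in> carrier R" "b \<in> carrier R" "a \<otimes> b \<in> \<Union>Q"
    then have "(I +> a) \<otimes>\<^bsub>R Quot I\<^esub> (I +> b) \<in> Q"
      using mem[of "a \<otimes> b"] h.hom_mult by simp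
    then show "a \<in> \<Union>Q \<or> b \<in> \<Union>Q"
      unfolding mem[OF ab(1)] mem[OF ab(2)] by (intro Q.I_prime h.hom_closed ab(1,2))
  qed
  have "I \<in> Q" using additive_subgroup.zero_closed[OF Q.additive_subgroup_axioms] by (simp only: FactRing_def ring_record_simps)
  then show "I \<subseteq> \<Union>Q" by (rule Union_upper)
qed

lemma (in cring) primeideal_quotient_image:
  assumes I: "ideal I R" and P: "primeideal P R" and "I \<subseteq> P"
  shows "primeideal ((+>) I ` P) (R Quot I)" and "\<Union>((+>) I ` P) = P"
proof -
  interpret P: primeideal P R by fact
  interpret h: ring_hom_ring R "R Quot I" "(+>) I" by (rule ideal.rcos_ring_hom_ring[OF I])
  have idP: "ideal P R" by (rule P.ideal_axioms)
  show un: "\<Union>((+>) I ` P) = P"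
    using ideal_incl_iff[OF I idP] \<open>I \<subseteq> P\<close> by auto
  have idQ: "ideal ((+>) I ` P) (R Quot I)" by (rule ring_ideal_imp_quot_ideal[OF I idP])
  have sub: "(+>) I ` P \<subseteq> carrier (R Quot I)"
    using additive_subgroup.a_subset ideal.axioms(1) idQ by blast
  note mem = canonical_proj_vimage_mem_iff[OF I sub, unfolded un]
  have carr: "\<exists>r\<in>carrier R. x = I +> r" if "x \<in> carrier (R Quot I)" for x
    using that unfolding FactRing_def A_RCOSETS_def'[of R I] by auto
  show "primeideal ((+>) I ` P) (R Quot I)"
  proof (rule primeidealI[OF idQ ideal.quotient_is_cring[OF I is_cring]])
    have "\<one> \<notin> P" using P.I_notcarr P.one_imp_carrier by auto
    then have "I +> \<one> \<notin> (+>) I ` P" using mem[of \<one>] by simp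
    then show "carrier (R Quot I) \<noteq> (+>) I ` P" using h.hom_closed[of \<one>] by auto
    fix x y assume "x \<in> carrier (R Quot I)" "y \<in> carrier (R Quot I)"
      and xy: "x \<otimes>\<^bsub>R Quot I\<^esub> y \<in> (+>) I ` P"
    then obtain a b where ab: "a \<in> carrier R" "b \<in> carrier R" "x = I +> a" "y = I +> b"
      using carr by metis
    then have "a \<otimes> b \<in> P" using xy mem[of "a \<otimes> b"] h.hom_mult[of a b] by simp
    then have "a \<in> P \<or> b \<in> P" using P.I_prime ab by blast
    then show "x \<in> (+>) I ` P \<or> y \<in> (+>) I ` P" using ab by auto
  qed
qed

text \<open>
  Taking preimages preserves strict inclusions because \<open>\<Union>\<close> and the image under the projection are
  mutually inverse between ideals containing \<open>I\<close> and ideals of the quotient.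
\<close>

lemma (in cring) krull_dim_quotient:
  assumes I: "ideal I R"
  shows "krull_dim (R Quot I) =
    Sup {enat n | n. \<exists>P. (\<forall>i\<le>n. primeideal (P i) R \<and> I \<subseteq> P i) \<and> (\<forall>i<n. P i \<subset> P (Suc i))}"
proof -
  have "(\<exists>Q. (\<forall>i\<le>n. primeideal (Q i) (R Quot I)) \<and> (\<forall>i<n. Q i \<subset> Q (Suc i))) \<longleftrightarrow>
    (\<exists>P. (\<forall>i\<le>n. primeideal (P i) R \<and> I \<subseteq> P i) \<and> (\<forall>i<n. P i \<subset> P (Suc i)))"
    (is "?L \<longleftrightarrow> ?R") for n :: nat
  proof
    assume ?L
    then obtain Q where Q: "\<And>i. i \<le> n \<Longrightarrow> primeideal (Q i) (R Quot I)"
      and lt: "\<And>i. i < n \<Longrightarrow> Q i \<subset> Q (Suc i)" by blast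
    have "\<Union>(Q i) \<subset> \<Union>(Q (Suc i))" if "i < n" for i
    proof -
      have ids: "ideal (Q j) (R Quot I)" if "j \<le> n" for j
        using Q[OF that] by (simp add: primeideal_def)
      have im: "(\<lambda>J. (+>) I ` J) ` {J. ideal J R \<and> I \<subseteq> J} = {J. ideal J (R Quot I)}"
        using quot_ideal_correspondence[OF I] by (auto simp: bij_betw_def)
      have rec: "(+>) I ` \<Union>J = J" if J: "ideal J (R Quot I)" for J
      proof -
        have "J \<in> (\<lambda>J. (+>) I ` J) ` {J. ideal J R \<and> I \<subseteq> J}" unfolding im using J by simp
        then obtain K where K: "ideal K R" "I \<subseteq> K" "J = (+>) I ` K" by (elim imageE) blast
        have "K = \<Union>((+>) I ` K)" using ideal_incl_iff[OF I K(1)] K(2) by (rule iffD1)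
        then show ?thesis unfolding K(3) by (simp only: sym[OF \<open>K = _\<close>])
      qed
      have "Q i \<noteq> Q (Suc i)" "Q i \<subseteq> Q (Suc i)" using lt[OF that] by auto
      moreover have "\<Union>(Q i) \<noteq> \<Union>(Q (Suc i))"
      proof
        assume eq: "\<Union>(Q i) = \<Union>(Q (Suc i))"
        have "Q i = (+>) I ` \<Union>(Q i)" by (rule sym, rule rec, rule ids) (use that in simp)
        also have "\<dots> = Q (Suc i)" unfolding eq by (rule rec, rule ids) (use that in simp)
        finally show False using \<open>Q i \<noteq> Q (Suc i)\<close> by simp
      qed
      ultimately show ?thesis by blast
    qed
    then show ?R using primeideal_quotient_Union[OF I Q] by (intro exI[of _ "\<lambda>i. \<Union>(Q i)"]) blast
  next
    assume ?R
    then obtain P where P: "\<And>i. i \<le> n \<Longrightarrow> primeideal (P i) R" "\<And>i. i \<le> n \<Longrightarrow> I \<subseteq> P i"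
      and lt: "\<And>i. i < n \<Longrightarrow> P i \<subset> P (Suc i)" by blast
    have "(+>) I ` P i \<subset> (+>) I ` P (Suc i)" if "i < n" for i
    proof
      show "(+>) I ` P i \<subseteq> (+>) I ` P (Suc i)"
        using lt[OF that] by (intro image_mono) blast
      show "(+>) I ` P i \<noteq> (+>) I ` P (Suc i)"
      proof
        assume eq: "(+>) I ` P i = (+>) I ` P (Suc i)"
        have "P i = \<Union>((+>) I ` P i)"
          by (rule sym, rule primeideal_quotient_image(2)[OF I]) (use that P in simp_all)
        also have "\<dots> = P (Suc i)"
          unfolding eq by (rule primeideal_quotient_image(2)[OF I]) (use that P in simp_all)
        finally show False using lt[OF that] by simp
      qed
    qed
    then show ?L
      by (intro exI[of _ "\<lambda>i. (+>) I ` P i"] conjI allI impI primeideal_quotient_image(1)[OF I P])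
  qed
  then show ?thesis unfolding krull_dim_def by simp
qed

section \<open>Ideals of rings given by a type\<close>

lemma ring_of_type_algebra_simps [simp]:
  "carrier (ring_of_type_algebra :: 'a::comm_ring_1 ring) = UNIV"
  "x \<otimes>\<^bsub>(ring_of_type_algebra :: 'a ring)\<^esub> y = x * y"
  "x \<oplus>\<^bsub>(ring_of_type_algebra :: 'a ring)\<^esub> y = x + y"
  "\<one>\<^bsub>(ring_of_type_algebra :: 'a ring)\<^esub> = 1"
  "\<zero>\<^bsub>(ring_of_type_algebra :: 'a ring)\<^esub> = 0"
  by (simp_all add: ring_of_type_algebra_def)

lemma ideal_of_type_algebra_iff:
  fixes I :: "'a::comm_ring_1 set"
  shows "ideal I ring_of_type_algebra \<longleftrightarrow>
    0 \<in> I \<and> (\<forall>a\<in>I. \<forall>b\<in>I. a + b \<in> I) \<and> (\<forall>a\<in>I. \<forall>x. x * a \<in> I)"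
proof
  assume "ideal I ring_of_type_algebra"
  then interpret ideal I "ring_of_type_algebra :: 'a ring" .
  show "0 \<in> I \<and> (\<forall>a\<in>I. \<forall>b\<in>I. a + b \<in> I) \<and> (\<forall>a\<in>I. \<forall>x. x * a \<in> I)"
    using additive_subgroup.zero_closed[OF additive_subgroup_axioms]
      additive_subgroup.a_closed[OF additive_subgroup_axioms] I_l_closed by auto
next
  assume *: "0 \<in> I \<and> (\<forall>a\<in>I. \<forall>b\<in>I. a + b \<in> I) \<and> (\<forall>a\<in>I. \<forall>x. x * a \<in> I)"
  interpret R: cring "ring_of_type_algebra :: 'a ring" by (rule cring_from_type_algebra)
  have minus: "\<ominus>\<^bsub>ring_of_type_algebra\<^esub> a = - a" for a :: 'a
    by (rule R.minus_equality) simp_all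
  show "ideal I ring_of_type_algebra"
  proof (rule idealI[OF R.ring_axioms])
    show "subgroup I (add_monoid (ring_of_type_algebra :: 'a ring))"
    proof (rule R.add.subgroupI)
      show "I \<subseteq> carrier ring_of_type_algebra" by simp
      show "I \<noteq> {}" using * by blast
      show "\<ominus>\<^bsub>ring_of_type_algebra\<^esub> a \<in> I" if "a \<in> I" for a
      proof -
        have "- 1 * a \<in> I" using * that by blast
        then show ?thesis unfolding minus by simp
      qed
      show "a \<oplus>\<^bsub>ring_of_type_algebra\<^esub> b \<in> I" if "a \<in> I" "b \<in> I" for a b
        using * that by simp
    qed
    show "x \<otimes>\<^bsub>ring_of_type_algebra\<^esub> a \<in> I" "a \<otimes>\<^bsub>ring_of_type_algebra\<^esub> x \<in> I" if "a \<in> I" for a x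
      using * that by (simp_all add: mult.commute[of a x])
  qed
qed

lemma primeideal_of_type_algebra_iff:
  fixes I :: "'a::comm_ring_1 set"
  shows "primeideal I ring_of_type_algebra \<longleftrightarrow>
    ideal I ring_of_type_algebra \<and> 1 \<notin> I \<and> (\<forall>a b. a * b \<in> I \<longrightarrow> a \<in> I \<or> b \<in> I)"
proof
  assume "primeideal I ring_of_type_algebra"
  then interpret primeideal I "ring_of_type_algebra :: 'a ring" .
  show "ideal I ring_of_type_algebra \<and> 1 \<notin> I \<and> (\<forall>a b. a * b \<in> I \<longrightarrow> a \<in> I \<or> b \<in> I)"
    using ideal_axioms I_prime I_notcarr one_imp_carrier by auto
next
  assume "ideal I ring_of_type_algebra \<and> 1 \<notin> I \<and> (\<forall>a b. a * b \<in> I \<longrightarrow> a \<in> I \<or> b \<in> I)"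
  then show "primeideal I ring_of_type_algebra"
    by (intro primeidealI cring_from_type_algebra) auto
qed

section \<open>Dimension of a quotient space from dual functionals\<close>

text \<open>
  Because \<open>quotient_dim\<close> counts an arbitrarily chosen basis of \<open>V/W\<close>, all bases have to be shown
  equally large. The map \<open>p v = (\<Sum>i\<in>J. c i v e i)\<close> is a projection whose kernel on \<open>V\<close> is \<open>W\<close>; it
  identifies \<open>V/W\<close> with the span of the \<open>e i\<close>, a subspace of the ambient vector space, where any
  two bases have the same size.
\<close>

lemma (in vector_space) quotient_dim_dual_basis:
  fixes c :: "'i \<Rightarrow> 'b \<Rightarrow> 'a"
  assumes J: "finite J"
    and V: "subspace V"
    and e: "\<And>i. i \<in> J \<Longrightarrow> e i \<in> V"
    and add: "\<And>i v w. i \<in> J \<Longrightarrow> c i (v + w) = c i v + c i w"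
    and scale: "\<And>i a v. i \<in> J \<Longrightarrow> c i (scale a v) = a * c i v"
    and dual: "\<And>i j. i \<in> J \<Longrightarrow> j \<in> J \<Longrightarrow> c i (e j) = (if i = j then 1 else 0)"
    and W: "\<And>v. v \<in> V \<Longrightarrow> v \<in> W \<longleftrightarrow> (\<forall>i\<in>J. c i v = 0)"
  shows "quotient_dim scale V W = card J"
proof -
  have c0: "c i 0 = 0" if "i \<in> J" for i using scale[OF that, of 0 0] by simp
  have csum: "c i (\<Sum>b\<in>T. scale (u b) (g b)) = (\<Sum>b\<in>T. u b * c i (g b))"
    if "i \<in> J" for i T u and g :: "'d \<Rightarrow> 'b"
    by (induction T rule: infinite_finite_induct) (simp_all add: that c0 add scale)
  have cdiff: "c i (v - w) = c i v - c i w" if "i \<in> J" for i v w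
    using add[OF that, of "v - w" w] by simp
  define p where "p v = (\<Sum>i\<in>J. scale (c i v) (e i))" for v
  have cp: "c i (p v) = c i v" if "i \<in> J" for i v
    using that J by (simp add: p_def csum dual if_distrib cong: if_cong)
  have sumV: "(\<Sum>b\<in>T. scale (u b) b) \<in> V" if "T \<subseteq> B" "B \<subseteq> V" for T B u
    using that by (intro subspace_sum[OF V] subspace_scale[OF V]) auto
  have pV: "p v \<in> V" for v
    unfolding p_def by (intro subspace_sum[OF V] subspace_scale[OF V] e)
  have inje: "inj_on e J"
    by (rule inj_onI) (metis dual zero_neq_one)
  have cardB: "card B = card J" if B: "quotient_basis scale V W B" for B
  proof -
    have BV: "B \<subseteq> V"
      and ind: "\<And>T u b. finite T \<Longrightarrow> T \<subseteq> B \<Longrightarrow> (\<Sum>b\<in>T. scale (u b) b) \<in> W \<Longrightarrow> b \<in> T \<Longrightarrow> u b = 0"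
      and sp: "\<And>v. v \<in> V \<Longrightarrow> \<exists>T u. finite T \<and> T \<subseteq> B \<and> v - (\<Sum>b\<in>T. scale (u b) b) \<in> W"
      using B unfolding quotient_basis_def by blast+
    have ind': "u b = 0" if "finite T" "T \<subseteq> B" "\<And>i. i \<in> J \<Longrightarrow> (\<Sum>b\<in>T. u b * c i b) = 0" "b \<in> T" for T u b
      using ind[OF that(1,2) _ that(4), of u] W[OF sumV[OF that(2) BV, of u]] csum[of _ u "\<lambda>x. x" T] that(3)
      by simp
    \<comment> \<open>If p a = p b, then a - b lies in W, a nontrivial linear relation modulo W.\<close>
    have injp: "inj_on p B"
    proof (rule inj_onI, rule ccontr)
      fix a b assume ab: "a \<in> B" "b \<in> B" "p a = p b" "a \<noteq> b"
      have "(\<Sum>x\<in>{a,b}. (if x = a then 1 else - 1) * c i x) = 0" if "i \<in> J" for i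
        using cp[OF that, of a] cp[OF that, of b] ab by simp
      from ind'[of "{a,b}" "\<lambda>x. if x = a then 1 else - 1" a, OF _ _ this] ab show False by auto
    qed
    have "independent (p ` B)"
      unfolding independent_explicit_finite_subsets
    proof (intro allI impI ballI)
      fix S u v assume S: "S \<subseteq> p ` B" "finite S" "(\<Sum>v\<in>S. scale (u v) v) = 0" "v \<in> S"
      obtain T where T: "T \<subseteq> B" "finite T" "S = p ` T"
        using finite_subset_image[OF S(2,1)] by blast
      have injT: "inj_on p T" using injp T(1) inj_on_subset by blast
      have "(\<Sum>b\<in>T. u (p b) * c i b) = 0" if "i \<in> J" for i
      proof -
        have "0 = c i (\<Sum>v\<in>S. scale (u v) v)" using S(3) c0 that by simp
        also have "\<dots> = (\<Sum>b\<in>T. u (p b) * c i b)"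
          by (simp add: T(3) sum.reindex[OF injT] csum[OF that] cp[OF that])
        finally show ?thesis by simp
      qed
      from ind'[OF T(2,1) this] show "u v = 0" using S(4) T(3) by auto
    qed
    moreover have "independent (e ` J)"
    proof (rule independent_if_scalars_zero)
      show "finite (e ` J)" using J by simp
      fix f x assume f: "(\<Sum>x\<in>e ` J. scale (f x) x) = 0" and "x \<in> e ` J"
      then obtain i where i: "i \<in> J" "x = e i" by blast
      have "0 = c i (\<Sum>j\<in>J. scale (f (e j)) (e j))"
        using f i c0 by (simp add: sum.reindex[OF inje])
      also have "\<dots> = f (e i)" using i J by (simp add: csum dual if_distrib cong: if_cong)
      finally show "f x = 0" using i by simp
    qed
    moreover have "span (p ` B) = span (e ` J)"
    proof (rule span_eq[THEN iffD2], intro conjI subsetI)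
      fix x assume "x \<in> p ` B"
      then obtain v where "x = p v" by blast
      then show "x \<in> span (e ` J)"
        unfolding p_def by (auto intro: span_sum span_scale span_base)
    next
      fix x assume "x \<in> e ` J"
      then obtain i where i: "i \<in> J" "x = e i" by blast
      obtain T u where T: "finite T" "T \<subseteq> B" "e i - (\<Sum>b\<in>T. scale (u b) b) \<in> W"
        using sp[OF e[OF i(1)]] by blast
      have inV: "e i - (\<Sum>b\<in>T. scale (u b) b) \<in> V"
        by (intro subspace_diff[OF V] e i sumV[OF T(2) BV])
      \<comment> \<open>Expanding e i in the basis B modulo W and applying p exhibits it in the span of p ` B.\<close>
      have *: "c j (e i) = (\<Sum>b\<in>T. u b * c j b)" if "j \<in> J" for j
      proof -
        have "c j (e i - (\<Sum>b\<in>T. scale (u b) b)) = 0"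
          using W[OF inV] T(3) that by blast
        then show ?thesis using cdiff[OF that] csum[OF that, of u "\<lambda>x. x" T] by simp
      qed
      have "e i = (\<Sum>j\<in>J. scale (c j (e i)) (e j))"
        using i J by (simp add: dual if_distrib[of "\<lambda>x. scale x _"] cong: if_cong)
      also have "\<dots> = (\<Sum>b\<in>T. scale (u b) (p b))"
        unfolding p_def scale_sum_right scale_scale
        by (subst sum.swap) (simp add: * scale_sum_left)
      also have "\<dots> \<in> span (p ` B)" using T(2) by (intro span_sum span_scale span_base) auto
      finally show "x \<in> span (p ` B)" using i by simp
    qed
    ultimately obtain f where "bij_betw f (p ` B) (e ` J)"
      using bij_if_span_eq_span_bases by blast
    then have "card (p ` B) = card (e ` J)" by (rule bij_betw_same_card)
    then show ?thesis by (simp add: card_image injp inje)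
  qed
  have "quotient_basis scale V W (e ` J)"
    unfolding quotient_basis_def
  proof (intro conjI allI impI ballI)
    show eV: "e ` J \<subseteq> V" using e by auto
    fix T u b assume T: "finite T \<and> T \<subseteq> e ` J \<and> (\<Sum>b\<in>T. scale (u b) b) \<in> W" and b: "b \<in> T"
    obtain i where i: "i \<in> J" "b = e i" using T b by blast
    have "0 = c i (\<Sum>b\<in>T. scale (u b) b)" using T W sumV[of T "e ` J" u] eV i by simp
    also have "\<dots> = (\<Sum>x\<in>T. u x * c i x)" by (rule csum[OF i(1)])
    also have "\<dots> = (\<Sum>x\<in>T. if x = b then u b else 0)"
      using T i inje by (intro sum.cong) (auto simp: dual inj_on_eq_iff)
    also have "\<dots> = u b" using T b by simp
    finally show "u b = 0" by simp
  next
    fix v assume v: "v \<in> V"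
    define u where "u b = c (the_inv_into J e b) v" for b
    have "(\<Sum>b\<in>e ` J. scale (u b) b) = p v"
      unfolding p_def by (simp add: sum.reindex[OF inje] u_def the_inv_into_f_f[OF inje])
    moreover have "v - p v \<in> W"
      using W[of "v - p v"] subspace_diff[OF V v pV] cdiff cp by simp
    ultimately show "\<exists>T u. finite T \<and> T \<subseteq> e ` J \<and> v - (\<Sum>b\<in>T. scale (u b) b) \<in> W"
      using J by (intro exI[of _ "e ` J"] exI[of _ u]) simp
  qed
  then have "quotient_basis scale V W (SOME B. quotient_basis scale V W B)"
    by (rule someI)
  then show ?thesis unfolding quotient_dim_def by (rule cardB)
qed

section \<open>Restriction of polynomials to a line through the origin\<close>

definition monomial_value :: "'k::field ^ 'n::finite \<Rightarrow> ('n \<Rightarrow>\<^sub>0 nat) \<Rightarrow> 'k" where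
  "monomial_value x m = (\<Prod>i\<in>UNIV. (x $ i) ^ Poly_Mapping.lookup m i)"

lemma monomial_value_add: "monomial_value x (m + m') = monomial_value x m * monomial_value x m'"
  by (simp add: monomial_value_def lookup_add power_add prod.distrib)

lemma monomial_value_zero [simp]: "monomial_value x 0 = 1"
  by (simp add: monomial_value_def)

lemma monomial_value_scale: "monomial_value (c *s x) m = c ^ mon_degree m * monomial_value x m"
  by (simp add: monomial_value_def mon_degree_def power_mult_distrib prod.distrib power_sum)

lemma monomial_value_single: "monomial_value x (Poly_Mapping.single i k) = (x $ i) ^ k"
proof -
  have "monomial_value x (Poly_Mapping.single i k) = (\<Prod>j\<in>UNIV. if j = i then (x $ i) ^ k else 1)"
    unfolding monomial_value_def by (intro prod.cong) (auto simp: lookup_single when_def)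
  then show ?thesis by simp
qed

lemma mon_degree_add: "mon_degree (m + m') = mon_degree m + mon_degree m'"
  by (simp add: mon_degree_def lookup_add sum.distrib)

lemma mon_degree_zero [simp]: "mon_degree 0 = 0"
  by (simp add: mon_degree_def)

lemma mon_degree_single [simp]: "mon_degree (Poly_Mapping.single i k) = k"
  by (simp add: mon_degree_def lookup_single when_def)

text \<open>
  The image of \<open>f\<close> under the substitution \<open>t_i \<mapsto> x_i T\<close>, that is, its restriction to the line through
  the origin and \<open>x\<close>. The coefficient of \<open>T^d\<close> is the value at \<open>x\<close> of the homogeneous component of
  degree \<open>d\<close>.
\<close>

definition line_restriction :: "'k::field ^ 'n::finite \<Rightarrow> ('n, 'k) mpoly \<Rightarrow> 'k poly" where
  "line_restriction x f = (\<Sum>m\<in>Poly_Mapping.keys f.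
     Polynomial.monom (Poly_Mapping.lookup f m * monomial_value x m) (mon_degree m))"

lemma line_restriction_superset:
  assumes "finite A" "Poly_Mapping.keys f \<subseteq> A"
  shows "line_restriction x f = (\<Sum>m\<in>A.
     Polynomial.monom (Poly_Mapping.lookup f m * monomial_value x m) (mon_degree m))"
  unfolding line_restriction_def using assms
  by (intro sum.mono_neutral_left) (auto simp: in_keys_iff)

lemma line_restriction_zero [simp]: "line_restriction x 0 = 0"
  by (simp add: line_restriction_def)

lemma line_restriction_add:
  "line_restriction x (f + g) = line_restriction x f + line_restriction x g"
proof -
  let ?A = "Poly_Mapping.keys f \<union> Poly_Mapping.keys g"
  have "Poly_Mapping.keys (f + g) \<subseteq> ?A" by (rule keys_add)
  then show ?thesis
    by (simp add: line_restriction_superset[of ?A] lookup_add distrib_right flip: add_monom sum.distrib)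
qed

lemma line_restriction_sum:
  "line_restriction x (\<Sum>a\<in>A. f a) = (\<Sum>a\<in>A. line_restriction x (f a))"
  by (induction A rule: infinite_finite_induct) (simp_all add: line_restriction_add)

lemma line_restriction_diff:
  "line_restriction x (f - g) = line_restriction x f - line_restriction x g"
  using line_restriction_add[of x "f - g" g] by simp

lemma line_restriction_single:
  "line_restriction x (Poly_Mapping.single m c) = Polynomial.monom (c * monomial_value x m) (mon_degree m)"
  by (simp add: line_restriction_superset[of "{m}"])

lemma mpoly_sum_terms: "f = (\<Sum>m\<in>Poly_Mapping.keys f. Poly_Mapping.single m (Poly_Mapping.lookup f m))"
  by (rule poly_mapping_eqI) (simp add: lookup_sum lookup_single when_def in_keys_iff)

lemma line_restriction_mult:
  fixes f g :: "('n::finite, 'k::field) mpoly"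
  shows "line_restriction x (f * g) = line_restriction x f * line_restriction x g"
proof -
  let ?s = "\<lambda>f m. Poly_Mapping.single m (Poly_Mapping.lookup f m)"
  have terms: "line_restriction x f = (\<Sum>m\<in>Poly_Mapping.keys f. line_restriction x (?s f m))"
    for f :: "('n, 'k) mpoly"
    by (simp add: line_restriction_single line_restriction_def[of x f])
  have "line_restriction x (f * g) =
    line_restriction x ((\<Sum>m\<in>Poly_Mapping.keys f. ?s f m) * (\<Sum>m\<in>Poly_Mapping.keys g. ?s g m))"
    by (simp flip: mpoly_sum_terms)
  also have "\<dots> = (\<Sum>m\<in>Poly_Mapping.keys f. \<Sum>m'\<in>Poly_Mapping.keys g.
      line_restriction x (?s f m) * line_restriction x (?s g m'))"
    by (simp add: sum_product line_restriction_sum mult_single line_restriction_single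
        mult_monom monomial_value_add mon_degree_add ac_simps)
  also have "\<dots> = line_restriction x f * line_restriction x g"
    unfolding terms[of f] terms[of g] sum_product ..
  finally show ?thesis .
qed

lemma line_restriction_one [simp]: "line_restriction x 1 = 1"
  using line_restriction_single[of x 0 1] by simp

lemma line_restriction_prod:
  "line_restriction x (\<Prod>a\<in>A. f a) = (\<Prod>a\<in>A. line_restriction x (f a))"
  by (induction A rule: infinite_finite_induct) (simp_all add: line_restriction_mult)

lemma line_restriction_power: "line_restriction x (f ^ k) = line_restriction x f ^ k"
  by (induction k) (simp_all add: line_restriction_mult)

lemma mpoly_eval_eq_line_restriction: "mpoly_eval f x = poly (line_restriction x f) 1"
  by (simp add: mpoly_eval_def line_restriction_def poly_sum poly_monom monomial_value_def)

lemma line_restriction_graded: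
  assumes "f \<in> graded_part d"
  shows "line_restriction x f = Polynomial.monom (mpoly_eval f x) d"
proof -
  have "line_restriction x f =
    (\<Sum>m\<in>Poly_Mapping.keys f. Polynomial.monom (Poly_Mapping.lookup f m * monomial_value x m) d)"
    unfolding line_restriction_def using assms by (intro sum.cong) (auto simp: graded_part_def)
  also have "\<dots> = Polynomial.monom (mpoly_eval f x) d"
    by (simp add: mpoly_eval_def monomial_value_def monom_sum)
  finally show ?thesis .
qed

lemma line_restriction_homogeneous_eq_0_iff:
  "homogeneous f \<Longrightarrow> line_restriction x f = 0 \<longleftrightarrow> mpoly_eval f x = 0"
  by (auto simp: homogeneous_def line_restriction_graded)

text \<open>
  Rescaling \<open>x\<close> rescales the parameter \<open>T\<close> of the line; hence vanishing of the restriction is a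
  property of the projective point.
\<close>

lemma coeff_line_restriction_scale:
  "poly.coeff (line_restriction (c *s x) f) d = c ^ d * poly.coeff (line_restriction x f) d"
  unfolding line_restriction_def
  by (auto simp: coeff_sum monomial_value_scale sum_distrib_left intro!: sum.cong)

lemma line_restriction_scale_eq_0_iff:
  assumes "c \<noteq> 0"
  shows "line_restriction (c *s x) f = 0 \<longleftrightarrow> line_restriction x f = 0"
  using assms by (simp add: poly_eq_iff coeff_line_restriction_scale)

section \<open>Homogeneous components\<close>

lemma graded_part_mult:
  assumes "f \<in> graded_part d" "g \<in> graded_part e"
  shows "f * g \<in> graded_part (d + e)"
  unfolding graded_part_def
proof (intro CollectI ballI)
  fix m assume "m \<in> Poly_Mapping.keys (f * g)"
  then obtain a b where "m = a + b" "a \<in> Poly_Mapping.keys f" "b \<in> Poly_Mapping.keys g"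
    using keys_mult[of f g] by blast
  then show "mon_degree m = d + e" using assms by (simp add: graded_part_def mon_degree_add)
qed

lemma graded_part_single: "mon_degree m = d \<Longrightarrow> Poly_Mapping.single m c \<in> graded_part d"
  by (simp add: graded_part_def)

lemma graded_part_one: "1 \<in> graded_part 0"
  by (simp add: graded_part_def)

lemma graded_part_power: "f \<in> graded_part d \<Longrightarrow> f ^ k \<in> graded_part (d * k)"
proof (induction k)
  case (Suc k)
  then show ?case using graded_part_mult[of f d "f ^ k" "d * k"] by simp
qed (simp add: graded_part_one)

lemma graded_part_prod:
  "(\<And>a. a \<in> A \<Longrightarrow> f a \<in> graded_part (d a)) \<Longrightarrow> (\<Prod>a\<in>A. f a) \<in> graded_part (\<Sum>a\<in>A. d a)"
  by (induction A rule: infinite_finite_induct) (simp_all add: graded_part_one graded_part_mult)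

lemma subspace_graded_part: "mpoly.subspace (graded_part d)"
proof (rule mpoly.subspaceI)
  show "0 \<in> graded_part d" by (simp add: graded_part_def)
  show "f + g \<in> graded_part d" if "f \<in> graded_part d" "g \<in> graded_part d" for f g
    using that keys_add[of f g] by (auto simp: graded_part_def)
  show "mpoly_scale c f \<in> graded_part d" if "f \<in> graded_part d" for c f
    unfolding mpoly_scale_def using graded_part_mult[OF graded_part_single[of 0 0 c] that] by simp
qed

definition homogeneous_component :: "nat \<Rightarrow> ('n::finite, 'k::field) mpoly \<Rightarrow> ('n, 'k) mpoly" where
  "homogeneous_component d f =
     (\<Sum>m\<in>{m \<in> Poly_Mapping.keys f. mon_degree m = d}. Poly_Mapping.single m (Poly_Mapping.lookup f m))"

lemma homogeneous_component_graded: "homogeneous_component d f \<in> graded_part d"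
  unfolding homogeneous_component_def
  by (intro mpoly.subspace_sum subspace_graded_part graded_part_single) simp

lemma sum_homogeneous_components:
  "f = (\<Sum>d\<in>mon_degree ` Poly_Mapping.keys f. homogeneous_component d f)"
  unfolding homogeneous_component_def
  by (subst sum.image_gen[symmetric]) (simp_all flip: mpoly_sum_terms)

lemma coeff_line_restriction:
  assumes "d \<in> mon_degree ` Poly_Mapping.keys f"
  shows "poly.coeff (line_restriction x f) d = mpoly_eval (homogeneous_component d f) x"
proof -
  have "line_restriction x f = (\<Sum>e\<in>mon_degree ` Poly_Mapping.keys f.
      Polynomial.monom (mpoly_eval (homogeneous_component e f) x) e)"
    by (subst sum_homogeneous_components)
      (simp add: line_restriction_sum line_restriction_graded[OF homogeneous_component_graded])
  then show ?thesis using assms by (simp add: coeff_sum)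
qed

section \<open>Points of projective space\<close>

lemma proj_spaceE:
  assumes "P \<in> proj_space"
  obtains x where "x \<noteq> 0" "P = {c *s x | c. c \<noteq> 0}"
proof -
  obtain x where x: "x \<noteq> 0" "P = {(x, y). x \<noteq> 0 \<and> y \<noteq> 0 \<and> (\<exists>c. c \<noteq> 0 \<and> y = c *s x)} `` {x}"
    using assms unfolding proj_space_def quotient_def by blast
  then have "P = {c *s x | c. c \<noteq> 0}" by auto
  with x(1) show ?thesis by (rule that)
qed

lemma proj_space_mem_iff:
  assumes "P \<in> proj_space" "x \<in> P"
  shows "y \<in> P \<longleftrightarrow> (\<exists>c. c \<noteq> 0 \<and> y = c *s x)" and "x \<noteq> 0"
proof -
  obtain z where z: "z \<noteq> 0" "P = {c *s z | c. c \<noteq> 0}" using proj_spaceE[OF assms(1)] .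
  obtain a where a: "a \<noteq> 0" "x = a *s z" using assms(2) z(2) by blast
  then show "x \<noteq> 0" using z(1) by simp
  have z_eq: "z = inverse a *s x" using a by (simp add: vector_smult_assoc)
  have P: "P = {b *s x | b. b \<noteq> 0}"
  proof (intro Set.set_eqI iffI)
    fix y assume "y \<in> P"
    then obtain b where b: "b \<noteq> 0" "y = b *s z" unfolding z(2) by blast
    have "y = (b * inverse a) *s x" unfolding b(2) by (subst z_eq) (rule vector_smult_assoc)
    moreover have "b * inverse a \<noteq> 0" using b(1) a(1) by simp
    ultimately show "y \<in> {b *s x | b. b \<noteq> 0}" by blast
  next
    fix y assume "y \<in> {b *s x | b. b \<noteq> 0}"
    then obtain b where b: "b \<noteq> 0" "y = b *s x" by blast
    have "y = (b * a) *s z" unfolding b(2) a(2) by (rule vector_smult_assoc)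
    moreover have "b * a \<noteq> 0" using b(1) a(1) by simp
    ultimately show "y \<in> P" unfolding z(2) by blast
  qed
  show "y \<in> P \<longleftrightarrow> (\<exists>c. c \<noteq> 0 \<and> y = c *s x)" unfolding P by blast
qed

lemma proj_space_eqI:
  assumes "P \<in> proj_space" "Q \<in> proj_space" "x \<in> P" "x \<in> Q"
  shows "P = Q"
  by (rule Set.set_eqI)
    (simp only: proj_space_mem_iff(1)[OF assms(1,3)] proj_space_mem_iff(1)[OF assms(2,4)])

lemma line_restriction_eq_0_on_point:
  assumes "P \<in> proj_space" "x \<in> P" "y \<in> P" "line_restriction x f = 0"
  shows "line_restriction y f = 0"
proof -
  obtain c where "c \<noteq> 0" "y = c *s x"
    using assms(3) unfolding proj_space_mem_iff(1)[OF assms(1,2)] by blast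
  then show ?thesis using assms(4) line_restriction_scale_eq_0_iff[of c x f] by simp
qed

definition representative :: "('k::field ^ 'n::finite) set \<Rightarrow> 'k ^ 'n" where
  "representative P = (SOME x. x \<in> P)"

lemma representative_mem: "P \<in> proj_space \<Longrightarrow> representative P \<in> P"
proof -
  assume "P \<in> proj_space"
  then obtain x where "P = {c *s x | c. c \<noteq> 0}" by (rule proj_spaceE)
  moreover have "1 *s x \<in> {c *s x | c. c \<noteq> 0}" by (intro CollectI exI[of _ 1]) simp
  ultimately have "1 *s x \<in> P" by simp
  then show ?thesis unfolding representative_def by (rule someI)
qed

section \<open>Vanishing ideals and their colon ideals\<close>

text \<open>
  The right-hand side is an ideal, being an intersection of kernels of homomorphisms, and it contains
  the generators. Conversely, if all restrictions of \<open>f\<close> vanish then so do all their coefficients,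
  which are the values of the homogeneous components of \<open>f\<close>; so \<open>f\<close> is a sum of generators. Comparing
  coefficients in \<open>K[T]\<close>, instead of values at the multiples of \<open>x\<close>, makes this valid for finite \<open>K\<close>.
\<close>

lemma mem_vanishing_ideal_iff:
  fixes f :: "('n::finite, 'k::field) mpoly"
  shows "f \<in> vanishing_ideal \<X> \<longleftrightarrow> (\<forall>P\<in>\<X>. \<forall>x\<in>P. line_restriction x f = 0)"
proof -
  interpret S: cring "poly_ring :: ('n, 'k) mpoly ring" by (rule cring_from_type_algebra)
  let ?G = "{f. homogeneous f \<and> (\<forall>P\<in>\<X>. vanishes_at f P)}"
  let ?I = "{f. \<forall>P\<in>\<X>. \<forall>x\<in>P. line_restriction x f = 0}"
  have "ideal ?I poly_ring"
    by (simp add: ideal_of_type_algebra_iff line_restriction_add line_restriction_mult)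
  moreover have "?G \<subseteq> ?I"
    by (auto simp: vanishes_at_def line_restriction_homogeneous_eq_0_iff)
  ultimately have "vanishing_ideal \<X> \<subseteq> ?I"
    unfolding vanishing_ideal_def by (rule S.genideal_minimal)
  moreover have "f \<in> vanishing_ideal \<X>" if f: "f \<in> ?I" for f
  proof -
    \<comment> \<open>The reverse inclusion: every homogeneous component of f is one of the generators.\<close>
    have id: "ideal (vanishing_ideal \<X>) poly_ring"
      unfolding vanishing_ideal_def by (rule S.genideal_ideal) simp
    have sum: "(\<Sum>a\<in>A. g a) \<in> vanishing_ideal \<X>"
      if "\<And>a. a \<in> A \<Longrightarrow> g a \<in> vanishing_ideal \<X>" for g and A :: "nat set"
      using that id[unfolded ideal_of_type_algebra_iff]
      by (induction A rule: infinite_finite_induct) simp_all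
    have "homogeneous_component d f \<in> vanishing_ideal \<X>"
      if d: "d \<in> mon_degree ` Poly_Mapping.keys f" for d
    proof -
      have "homogeneous_component d f \<in> ?G"
        using f homogeneous_component_graded[of d f]
        by (auto simp: vanishes_at_def homogeneous_def simp flip: coeff_line_restriction[OF d])
      then show ?thesis unfolding vanishing_ideal_def using S.genideal_self[of ?G] by auto
    qed
    then show ?thesis by (subst sum_homogeneous_components) (rule sum)
  qed
  ultimately show ?thesis by blast
qed

lemma ideal_vanishing_ideal: "ideal (vanishing_ideal \<X>) poly_ring"
  by (simp add: ideal_of_type_algebra_iff mem_vanishing_ideal_iff line_restriction_add
      line_restriction_mult)

text \<open>
  At a point where some \<open>f \<in> F\<close> does not vanish, the restriction of \<open>f\<close> to the line is a nonzero
  element of the domain \<open>K[T]\<close>, so \<open>g f\<close> restricts to zero exactly if \<open>g\<close> does. At the points of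
  \<open>V(F)\<close> the factor \<open>f\<close> takes care of the vanishing and \<open>g\<close> is unconstrained.
\<close>

lemma colon_vanishing_ideal:
  fixes \<X> :: "('k::field ^ 'n::finite) set set"
  assumes "\<X> \<subseteq> proj_space" and F: "\<And>f. f \<in> F \<Longrightarrow> homogeneous f"
  shows "colon_ideal (vanishing_ideal \<X>) F = vanishing_ideal (\<X> - zero_locus \<X> F)"
proof (intro Set.set_eqI iffI)
  fix g assume "g \<in> colon_ideal (vanishing_ideal \<X>) F"
  then have g: "line_restriction x g = 0 \<or> line_restriction x f = 0" if "f \<in> F" "P \<in> \<X>" "x \<in> P" for f P x
    using that by (auto simp: colon_ideal_def mem_vanishing_ideal_iff line_restriction_mult)
  show "g \<in> vanishing_ideal (\<X> - zero_locus \<X> F)"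
    unfolding mem_vanishing_ideal_iff
  proof (intro ballI)
    fix P x assume P: "P \<in> \<X> - zero_locus \<X> F" and x: "x \<in> P"
    then obtain f y where f: "f \<in> F" "y \<in> P" "mpoly_eval f y \<noteq> 0"
      by (auto simp: zero_locus_def vanishes_at_def)
    then have "line_restriction y f \<noteq> 0"
      using F line_restriction_homogeneous_eq_0_iff by blast
    then have "line_restriction x f \<noteq> 0"
      using line_restriction_eq_0_on_point[of P x y f] P x f assms(1) by blast
    then show "line_restriction x g = 0" using g[of f P x] P x f by blast
  qed
next
  fix g assume g: "g \<in> vanishing_ideal (\<X> - zero_locus \<X> F)"
  have "line_restriction x g = 0 \<or> line_restriction x f = 0" if "f \<in> F" "P \<in> \<X>" "x \<in> P" for f P x
  proof (cases "P \<in> zero_locus \<X> F")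
    case True
    then have "mpoly_eval f x = 0" using that by (simp add: zero_locus_def vanishes_at_def)
    then show ?thesis using F[OF that(1)] line_restriction_homogeneous_eq_0_iff by blast
  next
    case False
    then show ?thesis using g that by (simp add: mem_vanishing_ideal_iff)
  qed
  then show "g \<in> colon_ideal (vanishing_ideal \<X>) F"
    by (auto simp: colon_ideal_def mem_vanishing_ideal_iff line_restriction_mult)
qed

section \<open>The Hilbert function of a finite set of points\<close>

lemma mpoly_eval_mult: "mpoly_eval (f * g) x = mpoly_eval f x * mpoly_eval g x"
  and mpoly_eval_add: "mpoly_eval (f + g) x = mpoly_eval f x + mpoly_eval g x"
  and mpoly_eval_scale: "mpoly_eval (mpoly_scale c f) x = c * mpoly_eval f x"
  and mpoly_eval_power: "mpoly_eval (f ^ k) x = mpoly_eval f x ^ k"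
  and mpoly_eval_prod: "mpoly_eval (\<Prod>a\<in>A. F a) x = (\<Prod>a\<in>A. mpoly_eval (F a) x)"
  by (simp_all add: mpoly_eval_eq_line_restriction mpoly_scale_def line_restriction_mult
      line_restriction_add line_restriction_single line_restriction_power line_restriction_prod
      poly_monom poly_prod)

text \<open>
  The forms \<open>y_i t_j - y_j t_i\<close>, with \<open>i\<close> fixed such that \<open>y_i \<noteq> 0\<close>, all vanish at \<open>y\<close>, and their
  common zeros are the multiples of \<open>y\<close>. So one of them is nonzero at \<open>x\<close>.
\<close>

lemma separating_linear_form:
  fixes x y :: "'k::field ^ 'n::finite"
  assumes "P \<in> proj_space" "Q \<in> proj_space" "P \<noteq> Q" "x \<in> P" "y \<in> Q"
  obtains l :: "('n, 'k) mpoly" where "l \<in> graded_part 1" "mpoly_eval l y = 0" "mpoly_eval l x \<noteq> 0"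
proof -
  have "x \<noteq> 0" "y \<noteq> 0"
    using proj_space_mem_iff(2) assms by blast+
  obtain i where i: "y $ i \<noteq> 0" using \<open>y \<noteq> 0\<close> by (auto simp: vec_eq_iff)
  define l :: "'n \<Rightarrow> ('n, 'k) mpoly" where
    "l j = Poly_Mapping.single (Poly_Mapping.single j 1) (y $ i) +
      Poly_Mapping.single (Poly_Mapping.single i 1) (- (y $ j))" for j
  have eval: "mpoly_eval (l j) z = y $ i * z $ j - y $ j * z $ i" for j z
    by (simp add: l_def mpoly_eval_eq_line_restriction line_restriction_add line_restriction_single
        monomial_value_single poly_monom)
  have "\<exists>j. mpoly_eval (l j) x \<noteq> 0"
  proof (rule ccontr)
    assume "\<nexists>j. mpoly_eval (l j) x \<noteq> 0"
    then have eq: "y $ i * x $ j = y $ j * x $ i" for j using eval[of j x] by simp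
    have x: "x = (x $ i / y $ i) *s y"
      using i eq by (simp add: vec_eq_iff field_simps)
    then have "x $ i / y $ i \<noteq> 0" using \<open>x \<noteq> 0\<close> by (metis vector_smult_lzero)
    then have "x \<in> Q" using x proj_space_mem_iff(1)[OF assms(2,5), of x] by blast
    then have "P = Q" by (rule proj_space_eqI[OF assms(1,2,4)])
    then show False using assms(3) by simp
  qed
  then obtain j where j: "mpoly_eval (l j) x \<noteq> 0" by blast
  show ?thesis
  proof (rule that[of "l j"])
    show "l j \<in> graded_part 1"
      unfolding l_def
      by (intro mpoly.subspace_add subspace_graded_part graded_part_single) simp_all
    show "mpoly_eval (l j) y = 0" by (simp add: eval)
  qed (rule j)
qed

text \<open>
  The product of the linear forms that separate \<open>P\<close> from each of the other points has degree
  \<open>card \<Y> - 1\<close>. A power of a coordinate that is nonzero at \<open>P\<close> raises the degree to \<open>d\<close>, and a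
  scalar normalises the value at \<open>P\<close>.
\<close>

lemma separating_form:
  fixes \<Y> :: "('k::field ^ 'n::finite) set set"
  assumes Y: "finite \<Y>" "\<Y> \<subseteq> proj_space" and P: "P \<in> \<Y>" and d: "card \<Y> \<le> Suc d"
  obtains e :: "('n, 'k) mpoly" where "e \<in> graded_part d"
    "\<And>Q. Q \<in> \<Y> \<Longrightarrow> mpoly_eval e (representative Q) = (if Q = P then 1 else 0)"
proof -
  let ?r = representative
  have "\<exists>l :: ('n, 'k) mpoly. l \<in> graded_part 1 \<and> mpoly_eval l (?r Q) = 0 \<and> mpoly_eval l (?r P) \<noteq> 0"
    if Q: "Q \<in> \<Y> - {P}" for Q
  proof -
    have PQ: "P \<in> proj_space" "Q \<in> proj_space" "P \<noteq> Q" using Y P Q by auto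
    show ?thesis
      using separating_linear_form[OF PQ representative_mem[OF PQ(1)] representative_mem[OF PQ(2)]]
      by blast
  qed
  then obtain l :: "_ \<Rightarrow> ('n, 'k) mpoly" where
    l: "\<And>Q. Q \<in> \<Y> - {P} \<Longrightarrow>
      l Q \<in> graded_part 1 \<and> mpoly_eval (l Q) (?r Q) = 0 \<and> mpoly_eval (l Q) (?r P) \<noteq> 0"
    by metis
  have "?r P \<noteq> 0"
    using Y P by (intro proj_space_mem_iff(2)[of P] representative_mem) auto
  then obtain i where i: "?r P $ i \<noteq> 0" by (auto simp: vec_eq_iff)
  define t :: "('n, 'k) mpoly" where "t = Poly_Mapping.single (Poly_Mapping.single i 1) 1"
  have t: "t \<in> graded_part 1" "mpoly_eval t x = x $ i" for x
    by (simp_all add: t_def graded_part_single mpoly_eval_eq_line_restriction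
        line_restriction_single monomial_value_single poly_monom)
  define f where "f = (\<Prod>Q\<in>\<Y> - {P}. l Q) * t ^ (Suc d - card \<Y>)"
  have "f \<in> graded_part ((\<Sum>Q\<in>\<Y> - {P}. 1) + 1 * (Suc d - card \<Y>))"
    unfolding f_def using l
    by (intro graded_part_mult graded_part_prod graded_part_power t(1)) blast
  moreover have "(\<Sum>Q\<in>\<Y> - {P}. 1) + 1 * (Suc d - card \<Y>) = d"
  proof -
    have "0 < card \<Y>" using Y P by (auto simp: card_gt_0_iff)
    then show ?thesis using d P by simp
  qed
  ultimately have fd: "f \<in> graded_part d" by simp
  have fP: "mpoly_eval f (?r P) \<noteq> 0"
    using l i Y by (simp add: f_def mpoly_eval_mult mpoly_eval_prod mpoly_eval_power t(2))
  have fQ: "mpoly_eval f (?r Q) = 0" if "Q \<in> \<Y>" "Q \<noteq> P" for Q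
  proof -
    have "(\<Prod>R\<in>\<Y> - {P}. mpoly_eval (l R) (?r Q)) = 0"
      using l[of Q] that Y by (intro prod_zero) auto
    then show ?thesis by (simp add: f_def mpoly_eval_mult mpoly_eval_prod)
  qed
  show ?thesis
  proof (rule that[of "mpoly_scale (inverse (mpoly_eval f (?r P))) f"])
    show "mpoly_scale (inverse (mpoly_eval f (?r P))) f \<in> graded_part d"
      by (rule mpoly.subspace_scale[OF subspace_graded_part fd])
  qed (use fP fQ in \<open>auto simp: mpoly_eval_scale\<close>)
qed

text \<open>
  Evaluation at representatives of the points gives functionals on \<open>S_d\<close> that cut out the degree
  \<open>d\<close> part of the ideal, and the separating forms are dual to them.
\<close>

lemma hilbert_function_vanishing_ideal:
  fixes \<Y> :: "('k::field ^ 'n::finite) set set"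
  assumes Y: "finite \<Y>" "\<Y> \<subseteq> proj_space" and d: "card \<Y> \<le> Suc d"
  shows "hilbert_function (vanishing_ideal \<Y>) d = card \<Y>"
proof -
  have "\<exists>e :: ('n, 'k) mpoly. e \<in> graded_part d \<and>
      (\<forall>Q\<in>\<Y>. mpoly_eval e (representative Q) = (if Q = P then 1 else 0))"
    if P: "P \<in> \<Y>" for P
    by (rule separating_form[OF Y P d]) blast
  then obtain e :: "_ \<Rightarrow> ('n, 'k) mpoly" where
    e: "\<And>P. P \<in> \<Y> \<Longrightarrow> e P \<in> graded_part d"
      "\<And>P Q. P \<in> \<Y> \<Longrightarrow> Q \<in> \<Y> \<Longrightarrow> mpoly_eval (e P) (representative Q) = (if Q = P then 1 else 0)"
    by metis
  show ?thesis
    unfolding hilbert_function_def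
  proof (rule mpoly.quotient_dim_dual_basis[where e = e and c = "\<lambda>P f. mpoly_eval f (representative P)"])
    fix f :: "('n, 'k) mpoly" assume f: "f \<in> graded_part d"
    have "(\<forall>x\<in>P. line_restriction x f = 0) \<longleftrightarrow> mpoly_eval f (representative P) = 0" if "P \<in> \<Y>" for P
    proof -
      have P: "P \<in> proj_space" using that Y by blast
      have "homogeneous f" using f by (auto simp: homogeneous_def)
      then show ?thesis
        using line_restriction_homogeneous_eq_0_iff[of f "representative P"]
          line_restriction_eq_0_on_point[OF P representative_mem[OF P], of _ f]
          representative_mem[OF P] by blast
    qed
    then show "f \<in> vanishing_ideal \<Y> \<inter> graded_part d \<longleftrightarrow> (\<forall>P\<in>\<Y>. mpoly_eval f (representative P) = 0)"
      using f by (simp add: mem_vanishing_ideal_iff)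
  qed (use Y e in \<open>auto simp: subspace_graded_part mpoly_eval_add mpoly_eval_scale\<close>)
qed

section \<open>The Krull dimension for a finite set of points\<close>

text \<open>
  A nonzero element of least degree divides every element of the ideal, since the remainders have
  smaller degree.
\<close>

lemma poly_ideal_principal:
  fixes J :: "'k::field poly set"
  assumes J: "ideal J ring_of_type_algebra"
  obtains q where "q \<in> J" "\<And>f. f \<in> J \<Longrightarrow> q dvd f"
proof (cases "J \<subseteq> {0}")
  case True
  then show ?thesis using J that[of 0] by (auto simp: ideal_of_type_algebra_iff)
next
  case False
  then obtain q where q: "q \<in> J" "q \<noteq> 0"
    and min: "\<And>f. f \<in> J \<Longrightarrow> f \<noteq> 0 \<Longrightarrow> Polynomial.degree q \<le> Polynomial.degree f"
    using ex_has_least_nat[of "\<lambda>f. f \<in> J \<and> f \<noteq> 0" _ Polynomial.degree] by blast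
  have "q dvd f" if "f \<in> J" for f
  proof (rule ccontr)
    assume "\<not> q dvd f"
    then have *: "f mod q \<noteq> 0" by (simp add: dvd_eq_mod_eq_0)
    have "f + (- (f div q)) * q \<in> J"
      using J q that unfolding ideal_of_type_algebra_iff by blast
    then have "f mod q \<in> J" by (simp add: minus_div_mult_eq_mod[symmetric])
    then show False using min[OF _ *] degree_mod_less[of q f] q(2) * by force
  qed
  with q(1) show ?thesis by (rule that)
qed

text \<open>
  If \<open>x_i \<noteq> 0\<close> then \<open>t_i / x_i\<close> restricts to \<open>T\<close>.
\<close>

lemma surj_line_restriction:
  fixes x :: "'k::field ^ 'n::finite"
  assumes "x \<noteq> 0"
  shows "\<exists>f. line_restriction x f = h"
proof -
  obtain i where i: "x $ i \<noteq> 0" using assms by (auto simp: vec_eq_iff)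
  define s where "s k c = Poly_Mapping.single (Poly_Mapping.single i k) (c / (x $ i) ^ k)" for k c
  have s: "line_restriction x (s k c) = Polynomial.monom c k" for k c
    using i by (simp add: s_def line_restriction_single monomial_value_single)
  have "line_restriction x (\<Sum>k\<le>Polynomial.degree h. s k (poly.coeff h k)) = h"
    by (simp add: line_restriction_sum s poly_as_sum_of_monoms)
  then show ?thesis by blast
qed

text \<open>
  The ideal of finitely many points contains the product of the ideals of the single points. A prime
  ideal that contains it hence contains the ideal of one of the points, which is the kernel of
  the restriction to a line.
\<close>

lemma primeideal_contains_line_kernel:
  fixes \<Y> :: "('k::field ^ 'n::finite) set set"
  assumes Y: "finite \<Y>" "\<Y> \<subseteq> proj_space"
    and p: "primeideal p poly_ring" "vanishing_ideal \<Y> \<subseteq> p"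
  obtains x where "x \<noteq> 0" "\<And>f. line_restriction x f = 0 \<Longrightarrow> f \<in> p"
proof -
  let ?r = representative
  have prime: "ideal p poly_ring" "1 \<notin> p" "\<And>f g. f * g \<in> p \<Longrightarrow> f \<in> p \<or> g \<in> p"
    using p(1) unfolding primeideal_of_type_algebra_iff by auto
  have "\<exists>P\<in>\<Y>. \<forall>f. line_restriction (?r P) f = 0 \<longrightarrow> f \<in> p"
  proof (rule ccontr)
    assume "\<not> ?thesis"
    then obtain g where g: "\<And>P. P \<in> \<Y> \<Longrightarrow> line_restriction (?r P) (g P) = 0 \<and> g P \<notin> p" by metis
    have "(\<Prod>P\<in>\<Y>. g P) \<in> vanishing_ideal \<Y>"
      unfolding mem_vanishing_ideal_iff line_restriction_prod
    proof (intro ballI prod_zero[OF Y(1)])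
      fix P x assume "P \<in> \<Y>" "x \<in> P"
      then have P: "P \<in> proj_space" using Y by blast
      show "\<exists>P\<in>\<Y>. line_restriction x (g P) = 0"
        using g[OF \<open>P \<in> \<Y>\<close>] line_restriction_eq_0_on_point[OF P representative_mem[OF P] \<open>x \<in> P\<close>]
          \<open>P \<in> \<Y>\<close> by blast
    qed
    then have "(\<Prod>P\<in>\<Y>. g P) \<in> p" using p(2) by blast
    moreover have "(\<Prod>P\<in>A. g P) \<notin> p" if "A \<subseteq> \<Y>" for A
      using finite_subset[OF that Y(1)] that
      by (induction A rule: finite_induct) (use prime g in auto)
    ultimately show False by blast
  qed
  then obtain P where P: "P \<in> \<Y>" "\<And>f. line_restriction (?r P) f = 0 \<Longrightarrow> f \<in> p" by blast
  moreover have "?r P \<noteq> 0"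
    using Y P(1) by (intro proj_space_mem_iff(2)[of P] representative_mem) auto
  ultimately show ?thesis using that by blast
qed

text \<open>
  Restriction to the line identifies \<open>S\<close> modulo the kernel with \<open>K[T]\<close>, a principal ideal domain, in
  which a nonzero prime ideal is maximal. In terms of generators \<open>q1\<close>, \<open>q2\<close> of the images of
  \<open>p1 \<subset> p2\<close>, write \<open>q1 = q2 c\<close>. Primality of \<open>p1\<close> puts \<open>q2\<close> or \<open>c\<close> into the image of \<open>p1\<close>: the
  first makes \<open>p1\<close> and \<open>p2\<close> equal, the second makes \<open>q2\<close> a unit.
\<close>

lemma no_prime_chain_over_line_kernel:
  fixes x :: "'k::field ^ 'n::finite"
  assumes x: "x \<noteq> 0" and ker: "\<And>f. line_restriction x f = 0 \<Longrightarrow> f \<in> p0"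
    and p0: "ideal p0 poly_ring" and p1: "primeideal p1 poly_ring" and p2: "primeideal p2 poly_ring"
    and lt: "p0 \<subset> p1" "p1 \<subset> p2"
  shows False
proof -
  let ?\<phi> = "line_restriction x"
  \<comment> \<open>The kernel lies in p0, so an ideal above p0 is determined by its image in K[T].\<close>
  have mem: "f \<in> p \<longleftrightarrow> ?\<phi> f \<in> ?\<phi> ` p" if "ideal p poly_ring" "p0 \<subseteq> p" for f p
  proof
    assume "?\<phi> f \<in> ?\<phi> ` p"
    then obtain g where g: "g \<in> p" "?\<phi> f = ?\<phi> g" by blast
    then have "f - g \<in> p" using ker that(2) by (auto simp: line_restriction_diff)
    then have "(f - g) + g \<in> p" using that(1) g(1) unfolding ideal_of_type_algebra_iff by blast
    then show "f \<in> p" by simp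
  qed simp
  have ideal_image: "ideal (?\<phi> ` p) ring_of_type_algebra" if "ideal p poly_ring" for p
    unfolding ideal_of_type_algebra_iff
  proof (intro conjI ballI allI)
    note p = that[unfolded ideal_of_type_algebra_iff]
    show "0 \<in> ?\<phi> ` p" using p by (intro image_eqI[of _ _ 0]) auto
    fix a assume "a \<in> ?\<phi> ` p"
    then obtain f where f: "f \<in> p" "a = ?\<phi> f" by blast
    show "a + b \<in> ?\<phi> ` p" if "b \<in> ?\<phi> ` p" for b
    proof -
      obtain g where "g \<in> p" "b = ?\<phi> g" using \<open>b \<in> ?\<phi> ` p\<close> by blast
      then show ?thesis using f p by (intro image_eqI[of _ _ "f + g"]) (auto simp: line_restriction_add)
    qed
    show "h * a \<in> ?\<phi> ` p" for h
    proof -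
      obtain g where "?\<phi> g = h" using surj_line_restriction[OF x] by blast
      then show ?thesis using f p by (intro image_eqI[of _ _ "g * f"]) (auto simp: line_restriction_mult)
    qed
  qed
  have id: "ideal p1 poly_ring" "ideal p2 poly_ring" and one: "1 \<notin> p2"
    and prime: "\<And>f g. f * g \<in> p1 \<Longrightarrow> f \<in> p1 \<or> g \<in> p1"
    using p1 p2 by (auto simp: primeideal_of_type_algebra_iff)
  note mem1 = mem[OF id(1) psubset_imp_subset[OF lt(1)]]
  have "p0 \<subseteq> p2" using lt by blast
  note mem2 = mem[OF id(2) this]
  obtain q1 where q1: "q1 \<in> ?\<phi> ` p1" "\<And>h. h \<in> ?\<phi> ` p1 \<Longrightarrow> q1 dvd h"
    using poly_ideal_principal[OF ideal_image[OF id(1)]] by blast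
  obtain q2 where q2: "q2 \<in> ?\<phi> ` p2" "\<And>h. h \<in> ?\<phi> ` p2 \<Longrightarrow> q2 dvd h"
    using poly_ideal_principal[OF ideal_image[OF id(2)]] by blast
  obtain f1 where f1: "f1 \<in> p1" "q1 = ?\<phi> f1" using q1(1) by blast
  obtain f2 where f2: "f2 \<in> p2" "q2 = ?\<phi> f2" using q2(1) by blast
  have "q1 \<noteq> 0"
  proof
    assume "q1 = 0"
    then have "f \<in> p0" if "f \<in> p1" for f using q1(2)[of "?\<phi> f"] that ker by simp
    then show False using lt(1) by blast
  qed
  have "q2 dvd q1" using q2(2) f1 lt(2) by blast
  then obtain c where c: "q1 = q2 * c" by blast
  obtain g where g: "?\<phi> g = c" using surj_line_restriction[OF x] by blast
  have "?\<phi> (f2 * g) = ?\<phi> f1" using c f1(2) f2(2) g by (simp add: line_restriction_mult)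
  then have "f2 * g \<in> p1" using mem1[of "f2 * g"] f1(1) by simp
  then consider "f2 \<in> p1" | "g \<in> p1" using prime by blast
  then show False
  proof cases
    case 1
    have "f \<in> p1" if "f \<in> p2" for f
    proof -
      have "q1 dvd q2" using q1(2) 1 f2(2) by blast
      moreover have "q2 dvd ?\<phi> f" using q2(2) that by blast
      ultimately have "q1 dvd ?\<phi> f" by (rule dvd_trans)
      then obtain h where h: "?\<phi> f = h * q1" by (auto simp: dvd_def mult.commute)
      have "h * q1 \<in> ?\<phi> ` p1"
        using ideal_image[OF id(1)] q1(1) by (simp only: ideal_of_type_algebra_iff)
      then have "?\<phi> f \<in> ?\<phi> ` p1" unfolding h .
      then show ?thesis by (rule iffD2[OF mem1])
    qed
    then show False using lt(2) by blast
  next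
    case 2
    then have "q1 dvd c" using q1(2) g by blast
    then obtain h where h: "c = q1 * h" by blast
    have "q1 * (q2 * h) = q2 * (q1 * h)" by (rule mult.left_commute)
    also have "\<dots> = q1 * 1" by (simp only: h[symmetric] c[symmetric] mult_1_right)
    finally have "q2 * h = 1" using \<open>q1 \<noteq> 0\<close> by simp
    moreover have "h * q2 \<in> ?\<phi> ` p2"
      using ideal_image[OF id(2)] q2(1) by (simp only: ideal_of_type_algebra_iff)
    ultimately have "?\<phi> 1 \<in> ?\<phi> ` p2" by (simp only: mult.commute[of h] line_restriction_one)
    then show False using one mem2[of 1] by simp
  qed
qed

text \<open>
  A chain of three primes is excluded by the two preceding lemmas. A chain of two is
  formed by the ideal of a point of \<open>\<Y>\<close>, the kernel of the restriction to a line, and the ideal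
  generated by all the variables, which is the preimage of \<open>(T)\<close>.
\<close>

lemma krull_dim_vanishing_ideal:
  fixes \<Y> :: "('k::field ^ 'n::finite) set set"
  assumes Y: "finite \<Y>" "\<Y> \<subseteq> proj_space" "\<Y> \<noteq> {}"
  shows "krull_dim (poly_ring Quot vanishing_ideal \<Y>) = 1"
proof -
  interpret S: cring "poly_ring :: ('n, 'k) mpoly ring" by (rule cring_from_type_algebra)
  let ?C = "\<lambda>n P. (\<forall>i\<le>n. primeideal (P i) poly_ring \<and> vanishing_ideal \<Y> \<subseteq> P i) \<and>
    (\<forall>i<n. P i \<subset> P (Suc i))"
  have upper: "n \<le> 1" if "?C n P" for n :: nat and P
  proof (rule ccontr)
    assume "\<not> n \<le> 1"
    then have n: "0 < n" "1 < n" "1 \<le> n" "2 \<le> n" by auto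
    have prime: "primeideal (P i) poly_ring" "vanishing_ideal \<Y> \<subseteq> P i" if "i \<le> n" for i
      using \<open>?C n P\<close> that by auto
    have lt: "P 0 \<subset> P 1" "P 1 \<subset> P 2"
      using \<open>?C n P\<close> n by (simp_all add: numeral_2_eq_2)
    obtain x where x: "x \<noteq> 0" "\<And>f. line_restriction x f = 0 \<Longrightarrow> f \<in> P 0"
      using primeideal_contains_line_kernel[OF Y(1,2) prime(1,2)[of 0]] by blast
    have id: "ideal (P 0) poly_ring" using prime(1)[of 0] by (simp add: primeideal_def)
    show False
      by (rule no_prime_chain_over_line_kernel[OF x id prime(1)[OF n(3)] prime(1)[OF n(4)] lt])
  qed
  obtain P where "P \<in> \<Y>" using Y(3) by blast
  define x where "x = representative P"
  have P: "P \<in> proj_space" using \<open>P \<in> \<Y>\<close> Y by blast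
  have xP: "x \<in> P" unfolding x_def by (rule representative_mem[OF P])
  have "x \<noteq> 0" by (rule proj_space_mem_iff(2)[OF P xP])
  then obtain i where i: "x $ i \<noteq> 0" by (auto simp: vec_eq_iff)
  define p0 where "p0 = {f. line_restriction x f = 0}"
  define p1 where "p1 = {f. poly.coeff (line_restriction x f) 0 = 0}"
  have prime: "primeideal p0 poly_ring" "primeideal p1 poly_ring"
    by (auto simp: primeideal_of_type_algebra_iff ideal_of_type_algebra_iff p0_def p1_def
        line_restriction_add line_restriction_mult coeff_mult)
  have sub: "vanishing_ideal \<Y> \<subseteq> p0"
    using \<open>P \<in> \<Y>\<close> xP by (auto simp: p0_def mem_vanishing_ideal_iff)
  have lt: "p0 \<subset> p1"
  proof
    show "p0 \<subseteq> p1" by (auto simp: p0_def p1_def)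
    have "Poly_Mapping.single (Poly_Mapping.single i 1) 1 \<in> p1 - p0"
      using i by (simp add: p0_def p1_def line_restriction_single monomial_value_single)
    then show "p0 \<noteq> p1" by blast
  qed
  have "?C 1 (\<lambda>i. if i = 0 then p0 else p1)"
    using prime sub lt by auto
  then have "\<exists>P. ?C 1 P" by (rule exI[of "?C 1"])
  then have "enat 1 \<in> {enat n | n. \<exists>P. ?C n P}"
    by (intro CollectI exI[of _ "1 :: nat"] conjI[OF refl])
  then have "enat 1 \<le> Sup {enat n | n. \<exists>P. ?C n P}" by (rule Sup_upper)
  moreover have "Sup {enat n | n. \<exists>P. ?C n P} \<le> enat 1"
    by (rule Sup_least) (use upper in auto)
  ultimately show ?thesis
    unfolding S.krull_dim_quotient[OF ideal_vanishing_ideal] by (simp add: one_enat_def)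
qed

section \<open>The degree of a vanishing ideal\<close>

text \<open>
  For nonempty \<open>\<Y>\<close> the Krull dimension is \<open>1\<close>, so the degree is the limit of the Hilbert function,
  which is eventually constant. The empty set gives the unit ideal, of degree \<open>0\<close>.
\<close>

lemma quotient_degree_vanishing_ideal:
  fixes \<Y> :: "('k::field ^ 'n::finite) set set"
  assumes Y: "finite \<Y>" "\<Y> \<subseteq> proj_space"
  shows "quotient_degree (vanishing_ideal \<Y>) = real (card \<Y>)"
proof (cases "\<Y> = {}")
  case True
  then have "vanishing_ideal \<Y> = UNIV" by (auto simp: mem_vanishing_ideal_iff)
  then show ?thesis using True by (simp add: quotient_degree_def)
next
  case False
  then obtain P where "P \<in> \<Y>" by blast
  then have "P \<in> proj_space" using Y by blast
  then have "1 \<notin> vanishing_ideal \<Y>"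
    using representative_mem[of P] \<open>P \<in> \<Y>\<close> by (auto simp: mem_vanishing_ideal_iff)
  then have "vanishing_ideal \<Y> \<noteq> UNIV" by blast
  moreover have "eventually (\<lambda>d. card \<Y> \<le> Suc d) sequentially"
    by (rule eventually_sequentiallyI[of "card \<Y>"]) simp
  then have "eventually (\<lambda>d. real (hilbert_function (vanishing_ideal \<Y>) d) = real (card \<Y>)) sequentially"
    by (rule eventually_mono) (simp add: hilbert_function_vanishing_ideal[OF Y])
  then have "lim (\<lambda>d. real (hilbert_function (vanishing_ideal \<Y>) d)) = real (card \<Y>)"
    by (intro limI tendsto_eventually)
  ultimately show ?thesis
    by (simp add: quotient_degree_def krull_dim_vanishing_ideal[OF Y False] one_enat_def)
qed

theorem lemma3p2:
  fixes \<X> :: "('k::field ^ 'n::finite) set set"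
    and F :: "('n, 'k) mpoly set"
  assumes "\<X> \<subseteq> proj_space" and "finite \<X>"
    and "finite F" and "F \<noteq> {}"
    and "\<And>f. f \<in> F \<Longrightarrow> homogeneous f \<and> f \<noteq> 0"
  shows "real (card (\<X> - zero_locus \<X> F)) =
    (if colon_ideal (vanishing_ideal \<X>) F \<noteq> vanishing_ideal \<X>
     then quotient_degree (colon_ideal (vanishing_ideal \<X>) F)
     else quotient_degree (vanishing_ideal \<X>))"
proof -
  let ?Y = "\<X> - zero_locus \<X> F"
  have "colon_ideal (vanishing_ideal \<X>) F = vanishing_ideal ?Y"
    using assms(1,5) by (intro colon_vanishing_ideal) auto
  moreover have "quotient_degree (vanishing_ideal ?Y) = real (card ?Y)"
    using assms(1,2) by (intro quotient_degree_vanishing_ideal) auto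
  ultimately show ?thesis by (auto split: if_splits)
qed

end
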